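(* Let $A$ be a commutative multiplicative hyperring with identity element $1$, and let $u,v\in\mathbb{N}$ with $u>v$. Suppose there exists a strong $\mathcal{C}$-hyperideal $P$ of $A$ which is $(u+1,v+1)$-absorbing primary or $(u+1,v)$-absorbing primary, but which is not a $(u,v)$-absorbing primary hyperideal. Then $A$ is a local multiplicative hyperring.
   Context: $\mathbb{N}$ is the set of positive integers. A commutative multiplicative hyperring $(A,+,\circ)$ consists of an abelian group $(A,+)$ and a map $\circ$ from $A\times A$ to the nonempty subsets of $A$ which is associative ($\bigcup_{a\in y\circ z} x\circ a=\bigcup_{b\in x\circ y} b\circ z$), commutative ($x\circ y=y\circ x$), satisfies $(-x)\circ y=x\circ(-y)=-(x\circ y)$, and $(y+z)\circ x\subseteq y\circ x+z\circ x$, $x\circ(y+z)\subseteq x\circ y+x\circ z$. For subsets $B,C\subseteq A$, $B\circ C=\bigcup_{b\in B,c\in C} b\circ c$ and $B+C=\{b+c: b\in B, c\in C\}$; an iterated product $x_1\circ\cdots\circ x_n$ is a subset of $A$ (for $n=1$ it is $\{x_1\}$), also written $\bigcirc_{i=1}^n x_i$. An identity element $1$ satisfies $a\in 1\circ a$ for all $a\in A$. $x\in A$ is a unit if $1\in y\circ x$ for some $y\in A$; $U(A)$ is the set of units. A hyperideal is a nonempty subset $B\subseteq A$ with $x-y\in B$ for all $x,y\in B$ and $r\circ x\subseteq B$ for all $x\in B$, $r\in A$; it is proper if $B\ne A$. A proper hyperideal $B$ is maximal if the only hyperideal of $A$ strictly containing $B$ is $A$; $A$ is local if it has exactly one maximal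 hyperideal. A proper hyperideal $B$ is prime if $x\circ y\subseteq B$ ($x,y\in A$) implies $x\in B$ or $y\in B$. $rad(B)$ is the intersection of all prime hyperideals of $A$ containing $B$ (and $rad(B)=A$ if there are none). A hyperideal $B$ is a strong $\mathcal{C}$-hyperideal if for all $n,k_1,\dots,k_n\in\mathbb{N}$ and $x_{ij}\in A$, $\sum_{i=1}^n\bigl(\bigcirc_{j=1}^{k_i} x_{ij}\bigr)\cap B\neq\varnothing$ implies $\sum_{i=1}^n\bigl(\bigcirc_{j=1}^{k_i} x_{ij}\bigr)\subseteq B$. For $u,v\in\mathbb{N}$ with $u>v$, a proper hyperideal $P$ is $(u,v)$-absorbing primary if whenever $x_1,\dots,x_u\in A\setminus U(A)$ and $x_1\circ\cdots\circ x_u\subseteq P$, then $x_1\circ\cdots\circ x_v\subseteq P$ or $x_{v+1}\circ\cdots\circ x_u\subseteq rad(P)$. *)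

theory Defs
  imports Main "HOL-Library.Set_Algebras"
begin

text \<open>
  The hyperring \<open>A\<close> is the whole type \<open>'a\<close>, with its abelian group structure given by the type class.
  Sums of subsets are elementwise, as in \<^theory>\<open>HOL-Library.Set_Algebras\<close>; since \<open>-\<close> on sets is
  the complement, the elementwise negative of \<open>S\<close> is written \<open>uminus ` S\<close>.
\<close>

locale comm_mult_hyperring =
  fixes hmult :: "'a::ab_group_add \<Rightarrow> 'a \<Rightarrow> 'a set"  (infixl "\<odot>" 70)
  assumes hmult_nonempty: "x \<odot> y \<noteq> {}"
    and hmult_assoc: "(\<Union>a\<in>y \<odot> z. x \<odot> a) = (\<Union>b\<in>x \<odot> y. b \<odot> z)"
    and hmult_commute: "x \<odot> y = y \<odot> x"
    and hmult_minus_left: "(- x) \<odot> y = uminus ` (x \<odot> y)"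
    and hmult_minus_right: "x \<odot> (- y) = uminus ` (x \<odot> y)"
    and hmult_distrib_right: "(y + z) \<odot> x \<subseteq> y \<odot> x + z \<odot> x"
    and hmult_distrib_left: "x \<odot> (y + z) \<subseteq> x \<odot> y + x \<odot> z"
begin

definition hmult_set :: "'a set \<Rightarrow> 'a set \<Rightarrow> 'a set" where
  "hmult_set B C = (\<Union>b\<in>B. \<Union>c\<in>C. b \<odot> c)"

text \<open>Only products of nonempty lists are meaningful; the value at the empty list is a dummy.\<close>

fun hprod :: "'a list \<Rightarrow> 'a set" where
  "hprod [] = {}"
| "hprod [x] = {x}"
| "hprod (x # y # zs) = hmult_set {x} (hprod (y # zs))"

definition hyperideal :: "'a set \<Rightarrow> bool" where
  "hyperideal B \<longleftrightarrow>
     B \<noteq> {} \<and> (\<forall>x\<in>B. \<forall>y\<in>B. x - y \<in> B) \<and> (\<forall>r. \<forall>x\<in>B. r \<odot> x \<subseteq> B)"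

definition proper_hyperideal :: "'a set \<Rightarrow> bool" where
  "proper_hyperideal B \<longleftrightarrow> hyperideal B \<and> B \<noteq> UNIV"

definition maximal_hyperideal :: "'a set \<Rightarrow> bool" where
  "maximal_hyperideal B \<longleftrightarrow>
     proper_hyperideal B \<and> (\<forall>C. hyperideal C \<and> B \<subset> C \<longrightarrow> C = UNIV)"

definition local_hyperring :: bool where
  "local_hyperring \<longleftrightarrow> (\<exists>!M. maximal_hyperideal M)"

definition prime_hyperideal :: "'a set \<Rightarrow> bool" where
  "prime_hyperideal B \<longleftrightarrow>
     proper_hyperideal B \<and> (\<forall>x y. x \<odot> y \<subseteq> B \<longrightarrow> x \<in> B \<or> y \<in> B)"

text \<open>If no prime hyperideal contains \<open>B\<close>, the empty intersection makes this \<open>UNIV\<close>.\<close>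

definition rad :: "'a set \<Rightarrow> 'a set" where
  "rad B = \<Inter>{Q. prime_hyperideal Q \<and> B \<subseteq> Q}"

text \<open>
  A finite sum of finite products is encoded by the nonempty list of its summands, each of which
  is the nonempty list of its factors.
\<close>

definition strong_C_hyperideal :: "'a set \<Rightarrow> bool" where
  "strong_C_hyperideal B \<longleftrightarrow> hyperideal B \<and>
     (\<forall>xss. xss \<noteq> [] \<and> (\<forall>xs\<in>set xss. xs \<noteq> []) \<longrightarrow>
        (\<Sum>xs\<leftarrow>xss. hprod xs) \<inter> B \<noteq> {} \<longrightarrow> (\<Sum>xs\<leftarrow>xss. hprod xs) \<subseteq> B)"

end

locale comm_mult_hyperring_1 = comm_mult_hyperring hmult
  for hmult :: "'a::ab_group_add \<Rightarrow> 'a \<Rightarrow> 'a set"  (infixl "\<odot>" 70) +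
  fixes one :: 'a  ("\<one>")
  assumes one_hmult: "a \<in> \<one> \<odot> a"
begin

definition hunits :: "'a set" where
  "hunits = {x. \<exists>y. \<one> \<in> y \<odot> x}"

text \<open>Intended for \<open>0 < v < u\<close>, so that all three products below are over nonempty lists.\<close>

definition absorbing_primary :: "nat \<Rightarrow> nat \<Rightarrow> 'a set \<Rightarrow> bool" where
  "absorbing_primary u v P \<longleftrightarrow> proper_hyperideal P \<and>
     (\<forall>xs. length xs = u \<and> set xs \<subseteq> UNIV - hunits \<and> hprod xs \<subseteq> P \<longrightarrow>
        hprod (take v xs) \<subseteq> P \<or> hprod (drop v xs) \<subseteq> rad P)"

end

end

(*
  A failure of the (u,v)-condition yields a hyperideal J (either P or rad P) and an element s outside J
  with z o s contained in J for every nonunit z: insert z between the two blocks of the witnessing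
  product and apply the (u+1)-condition. If a sum z + w of nonunits had 1 in y o (z + w), then
  s would lie in y o (z + w) o s, hence in J. So the nonunits are closed under addition, which makes
  them a hyperideal, necessarily the unique maximal one.
*)
theory Submission imports Defs begin

context comm_mult_hyperring
begin

lemma hmult_set_commute: "hmult_set B C = hmult_set C B"
  unfolding hmult_set_def using hmult_commute by blast

lemma hmult_set_assoc: "hmult_set (hmult_set B C) D = hmult_set B (hmult_set C D)"
proof -
  have "hmult_set (hmult_set B C) D = (\<Union>x\<in>B. \<Union>y\<in>C. \<Union>z\<in>D. \<Union>b\<in>x \<odot> y. b \<odot> z)"
    unfolding hmult_set_def by blast
  also have "\<dots> = (\<Union>x\<in>B. \<Union>y\<in>C. \<Union>z\<in>D. \<Union>a\<in>y \<odot> z. x \<odot> a)"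
    by (intro SUP_cong refl hmult_assoc[symmetric])
  also have "\<dots> = hmult_set B (hmult_set C D)"
    unfolding hmult_set_def by blast
  finally show ?thesis .
qed

lemma hprod_Cons: "xs \<noteq> [] \<Longrightarrow> hprod (x # xs) = hmult_set {x} (hprod xs)"
  by (cases xs) auto

text \<open>Both lists must be nonempty: the dummy value \<open>{}\<close> of
  \<open>hprod []\<close> is absorbing for \<open>hmult_set\<close>, not neutral.\<close>

lemma hprod_append:
  "xs \<noteq> [] \<Longrightarrow> ys \<noteq> [] \<Longrightarrow> hprod (xs @ ys) = hmult_set (hprod xs) (hprod ys)"
  by (induction xs rule: hprod.induct) (auto simp: hprod_Cons hmult_set_assoc)

text \<open>Associativity and commutativity move the inserted factor to the front, so inserting any
  factor keeps a product inside a hyperideal.\<close>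

lemma hprod_insert:
  assumes "xs \<noteq> []" "ys \<noteq> []"
  shows "hprod (xs @ z # ys) = hmult_set {z} (hprod (xs @ ys))"
proof -
  have "hprod (xs @ z # ys) = hmult_set (hprod xs) (hmult_set {z} (hprod ys))"
    using assms by (simp add: hprod_append hprod_Cons)
  also have "\<dots> = hmult_set (hmult_set {z} (hprod xs)) (hprod ys)"
    by (simp only: hmult_set_commute[of "{z}" "hprod xs"] hmult_set_assoc)
  also have "\<dots> = hmult_set {z} (hprod (xs @ ys))"
    by (simp only: hprod_append[OF assms] hmult_set_assoc)
  finally show ?thesis .
qed

lemma hyperideal_diff: "hyperideal B \<Longrightarrow> x \<in> B \<Longrightarrow> y \<in> B \<Longrightarrow> x - y \<in> B"
  unfolding hyperideal_def by blast

lemma hyperideal_hmult: "hyperideal B \<Longrightarrow> x \<in> B \<Longrightarrow> r \<odot> x \<subseteq> B"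
  unfolding hyperideal_def by blast

lemma hyperideal_0:
  assumes "hyperideal B"
  shows "0 \<in> B"
proof -
  obtain x where "x \<in> B"
    using assms unfolding hyperideal_def by blast
  then show ?thesis
    using hyperideal_diff[OF assms, of x x] by simp
qed

lemma hyperideal_add:
  assumes "hyperideal B" "x \<in> B" "y \<in> B"
  shows "x + y \<in> B"
proof -
  have "x - (0 - y) \<in> B"
    using assms hyperideal_0 hyperideal_diff by blast
  then show ?thesis by simp
qed

lemma hyperideal_hmult_set: "hyperideal B \<Longrightarrow> C \<subseteq> B \<Longrightarrow> hmult_set D C \<subseteq> B"
  unfolding hmult_set_def using hyperideal_hmult by blast

lemma hyperideal_Inter:
  assumes "\<And>B. B \<in> \<B> \<Longrightarrow> hyperideal B"
  shows "hyperideal (\<Inter>\<B>)"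
proof -
  \<comment> \<open>As a common element, 0 gives nonemptiness even for the empty family, whose
    intersection is \<open>UNIV\<close>.\<close>
  have "0 \<in> \<Inter>\<B>"
    using assms hyperideal_0 by blast
  moreover have "\<forall>x\<in>\<Inter>\<B>. \<forall>y\<in>\<Inter>\<B>. x - y \<in> \<Inter>\<B>"
    using assms hyperideal_diff by blast
  moreover have "\<forall>r. \<forall>x\<in>\<Inter>\<B>. r \<odot> x \<subseteq> \<Inter>\<B>"
    using assms hyperideal_hmult by blast
  ultimately show ?thesis
    unfolding hyperideal_def by blast
qed

lemma hyperideal_rad: "hyperideal (rad B)"
  unfolding rad_def
  by (rule hyperideal_Inter) (auto simp: prime_hyperideal_def proper_hyperideal_def)

end

context comm_mult_hyperring_1
begin

lemma one_in_hunits: "\<one> \<in> hunits"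
  unfolding hunits_def using one_hmult by blast

text \<open>Absorption first puts \<one> into \<open>B\<close>, and then every \<open>a\<close>,
  which lies in \<open>a \<odot> \<one>\<close>.\<close>

lemma hyperideal_unit_UNIV:
  assumes "hyperideal B" "x \<in> B" "x \<in> hunits"
  shows "B = UNIV"
proof -
  have "\<one> \<in> B"
    using assms hyperideal_hmult unfolding hunits_def by blast
  then have "a \<in> B" for a
    using hyperideal_hmult[OF assms(1), of \<one> a] one_hmult[of a] hmult_commute[of a \<one>] by blast
  then show ?thesis by blast
qed

lemma hunits_uminus:
  assumes "- z \<in> hunits"
  shows "z \<in> hunits"
proof -
  obtain y where "\<one> \<in> y \<odot> (- z)"
    using assms unfolding hunits_def by blast
  then have "\<one> \<in> (- y) \<odot> z"
    by (simp only: hmult_minus_left hmult_minus_right)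
  then show ?thesis
    unfolding hunits_def by blast
qed

text \<open>If \<one> lies in \<open>y \<odot> t\<close>, associativity puts it in
  \<open>b \<odot> z\<close> for some \<open>b\<close> in \<open>y \<odot> r\<close>. By
  contraposition, nonunits absorb multiplication.\<close>

lemma hunits_hmult:
  assumes "t \<in> r \<odot> z" "t \<in> hunits"
  shows "z \<in> hunits"
proof -
  obtain y where "\<one> \<in> y \<odot> t"
    using assms(2) unfolding hunits_def by blast
  then have "\<one> \<in> (\<Union>b\<in>y \<odot> r. b \<odot> z)"
    using assms(1) hmult_assoc[of y r z] by blast
  then show ?thesis
    unfolding hunits_def by blast
qed

text \<open>This replaces cancelling a unit: if \<one> lies in \<open>y \<odot> t\<close>, then
  \<open>s\<close>, an element of \<open>\<one> \<odot> s\<close>, lies in a product of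
  \<open>y\<close> with an element of \<open>t \<odot> s\<close>, hence in \<open>J\<close>.\<close>

lemma unit_annihilates_mod_hyperideal:
  assumes "hyperideal J" "t \<in> hunits" "t \<odot> s \<subseteq> J"
  shows "s \<in> J"
proof -
  obtain y where "\<one> \<in> y \<odot> t"
    using assms(2) unfolding hunits_def by blast
  then have "s \<in> (\<Union>b\<in>y \<odot> t. b \<odot> s)"
    using one_hmult by blast
  then have "s \<in> (\<Union>a\<in>t \<odot> s. y \<odot> a)"
    using hmult_assoc[of y t s] by blast
  then show ?thesis
    using assms(1,3) hyperideal_hmult by blast
qed

text \<open>Proper hyperideals contain no units, so the set of nonunits, once a hyperideal, is the
  largest proper one.\<close>

lemma local_hyperring_if_hyperideal_nonunits:
  assumes "hyperideal (- hunits)"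
  shows "local_hyperring"
proof -
  have sub: "B \<subseteq> - hunits" if "proper_hyperideal B" for B
    using that hyperideal_unit_UNIV unfolding proper_hyperideal_def by blast
  have proper: "proper_hyperideal (- hunits)"
    using assms one_in_hunits unfolding proper_hyperideal_def by blast
  have "maximal_hyperideal (- hunits)"
    unfolding maximal_hyperideal_def
  proof (intro conjI allI impI)
    fix C assume "hyperideal C \<and> - hunits \<subset> C"
    then show "C = UNIV"
      using sub[of C] unfolding proper_hyperideal_def by blast
  qed (rule proper)
  \<comment> \<open>A strict inclusion would, by maximality of \<open>M\<close>, make
    \<open>- hunits\<close> all of \<open>UNIV\<close>, although \<one> is a unit.\<close>
  moreover have "M = - hunits" if "maximal_hyperideal M" for M
    using that sub[of M] assms one_in_hunits unfolding maximal_hyperideal_def by blast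
  ultimately show ?thesis
    unfolding local_hyperring_def by blast
qed

lemma local_hyperring_if_nonunits_annihilate:
  assumes J: "hyperideal J" and s: "s \<notin> J"
    and ann: "\<And>z. z \<notin> hunits \<Longrightarrow> z \<odot> s \<subseteq> J"
  shows "local_hyperring"
proof (rule local_hyperring_if_hyperideal_nonunits, unfold hyperideal_def, intro conjI ballI allI)
  \<comment> \<open>The witness is 0: were it a unit, \<open>J\<close> would be \<open>UNIV\<close>
    and contain \<open>s\<close>.\<close>
  show "- hunits \<noteq> {}"
    using hyperideal_unit_UNIV[OF J hyperideal_0[OF J]] s by blast
next
  fix x y assume "x \<in> - hunits" "y \<in> - hunits"
  then have "x \<odot> s \<subseteq> J" "- y \<odot> s \<subseteq> J"
    using ann hunits_uminus by blast+
  then have "x \<odot> s + (- y) \<odot> s \<subseteq> J"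
    using hyperideal_add[OF J] by (blast elim: set_plus_elim)
  \<comment> \<open>Distributivity is only an inclusion, but in the direction required here.\<close>
  then have "(x - y) \<odot> s \<subseteq> J"
    using hmult_distrib_right[of x "- y" s] by simp
  then show "x - y \<in> - hunits"
    using unit_annihilates_mod_hyperideal[OF J] s by blast
next
  fix r x assume "x \<in> - hunits"
  then show "r \<odot> x \<subseteq> - hunits"
    using hunits_hmult by blast
qed

lemma local_hyperring_if_nonunits_annihilate_set:
  assumes "hyperideal J" "\<not> S \<subseteq> J" "\<And>z. z \<notin> hunits \<Longrightarrow> hmult_set {z} S \<subseteq> J"
  shows "local_hyperring"
proof -
  obtain s where s: "s \<in> S" "s \<notin> J"
    using assms(2) by blast
  show ?thesis
  proof (rule local_hyperring_if_nonunits_annihilate[OF assms(1) s(2)])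
    show "z \<odot> s \<subseteq> J" if "z \<notin> hunits" for z
      using assms(3)[OF that] s(1) unfolding hmult_set_def by blast
  qed
qed

text \<open>The nonunit \<open>z\<close> is inserted exactly at the cut: cutting at
  \<open>v + 1\<close> adds it to the left block, cutting at \<open>v\<close> to the right one. The
  other block is unchanged, so its failed inclusion rules out one alternative.\<close>

lemma local_hyperring_if_absorbing_primary_Suc:
  assumes uv: "0 < v" "v < u"
    and abs: "absorbing_primary (u + 1) (v + 1) P \<or> absorbing_primary (u + 1) v P"
    and nabs: "\<not> absorbing_primary u v P"
  shows "local_hyperring"
proof -
  \<comment> \<open>With properness secured, the failure in \<open>nabs\<close> must come from a
    product.\<close>
  have P: "proper_hyperideal P"
    using abs unfolding absorbing_primary_def by blast
  then have hP: "hyperideal P"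
    unfolding proper_hyperideal_def by blast
  obtain ws where ws: "length ws = u" "set ws \<subseteq> UNIV - hunits" "hprod ws \<subseteq> P"
    and nP: "\<not> hprod (take v ws) \<subseteq> P" and nrad: "\<not> hprod (drop v ws) \<subseteq> rad P"
    using nabs P unfolding absorbing_primary_def by blast
  define xs ys where "xs = take v ws" and "ys = drop v ws"
  have ne: "xs \<noteq> []" "ys \<noteq> []" and len: "length xs = v" "length (xs @ ys) = u"
    and app: "xs @ ys = ws"
    using uv ws(1) by (auto simp: xs_def ys_def)
  have P_z: "hprod (xs @ z # ys) \<subseteq> P" for z
    using hprod_insert[OF ne] hyperideal_hmult_set[OF hP] ws(3) app by simp
  have adm: "length (xs @ z # ys) = u + 1" "set (xs @ z # ys) \<subseteq> UNIV - hunits"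
    if "z \<notin> hunits" for z
    using that ws(2) len by (auto simp flip: app)
  from abs show ?thesis
  proof
    assume abs1: "absorbing_primary (u + 1) (v + 1) P"
    show ?thesis
    \<comment> \<open>Here \<open>J\<close> is \<open>P\<close> and \<open>S\<close> is the left
      block \<open>hprod xs\<close>.\<close>
    proof (rule local_hyperring_if_nonunits_annihilate_set[OF hP])
      show "\<not> hprod xs \<subseteq> P"
        using nP by (simp add: xs_def)
      fix z assume z: "z \<notin> hunits"
      have "hprod (take (v + 1) (xs @ z # ys)) \<subseteq> P \<or> hprod (drop (v + 1) (xs @ z # ys)) \<subseteq> rad P"
        using abs1 adm[OF z] P_z unfolding absorbing_primary_def by blast
      then have "hprod (xs @ [z]) \<subseteq> P"
        using len nrad by (simp add: ys_def)
      then show "hmult_set {z} (hprod xs) \<subseteq> P"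
        using ne by (simp add: hprod_append hmult_set_commute)
    qed
  next
    assume abs2: "absorbing_primary (u + 1) v P"
    show ?thesis
    \<comment> \<open>Now \<open>J\<close> is \<open>rad P\<close> and \<open>S\<close> is the right
      block \<open>hprod ys\<close>.\<close>
    proof (rule local_hyperring_if_nonunits_annihilate_set[OF hyperideal_rad])
      show "\<not> hprod ys \<subseteq> rad P"
        using nrad by (simp add: ys_def)
      fix z assume z: "z \<notin> hunits"
      have "hprod (take v (xs @ z # ys)) \<subseteq> P \<or> hprod (drop v (xs @ z # ys)) \<subseteq> rad P"
        using abs2 adm[OF z] P_z unfolding absorbing_primary_def by blast
      then have "hprod (z # ys) \<subseteq> rad P"
        using len nP by (simp add: xs_def)
      then show "hmult_set {z} (hprod ys) \<subseteq> rad P"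
        using ne by (simp add: hprod_Cons)
    qed
  qed
qed

end

theorem theorem2p12:
  fixes hmult :: "'a::ab_group_add \<Rightarrow> 'a \<Rightarrow> 'a set"
    and one :: 'a
    and u v :: nat
  assumes "comm_mult_hyperring_1 hmult one"
    and "0 < v" and "v < u"
    and "\<exists>P. comm_mult_hyperring.strong_C_hyperideal hmult P \<and>
           (comm_mult_hyperring_1.absorbing_primary hmult one (u + 1) (v + 1) P \<or>
            comm_mult_hyperring_1.absorbing_primary hmult one (u + 1) v P) \<and>
           \<not> comm_mult_hyperring_1.absorbing_primary hmult one u v P"
  shows "comm_mult_hyperring.local_hyperring hmult"
  using comm_mult_hyperring_1.local_hyperring_if_absorbing_primary_Suc[OF assms(1-3)] assms(4)
  by blast

end
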